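(* For every $n\in\mathbb{N}$, independently, choose a subset $P_n\subseteq[n]=\{1,\dots,n\}$ uniformly at random among all $2^n$ subsets of $[n]$, and let $P=(P_n)_{n=1}^\infty$. For $\Psi:\mathbb{N}\to\mathbb{R}_{\geq 0}$ put \[ W^P(\Psi):=\left\{x\in[0,1]: \left|x-\frac{a}{n}\right|<\Psi(n)\text{ for infinitely many } n\in\mathbb{N},\ a\in P_n\right\}. \] Then, with probability one, the following holds: for every non-increasing $\Psi:\mathbb{N}\to\mathbb{R}_{\geq 0}$, \[ \lambda\left(W^P(\Psi)\right)=\begin{cases}1 & \text{if } \sum_{n=1}^\infty n\Psi(n)=\infty,\\ 0 & \text{if } \sum_{n=1}^\infty n\Psi(n)<\infty,\end{cases} \] where $\lambda$ is Lebesgue measure.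
   Context: $[n]=\{1,\dots,n\}$; the choices of $P_n$ for different $n$ are independent. *)

theory Defs
  imports "HOL-Probability.Probability"
begin

text \<open>The index \<open>n\<close> ranges over the positive integers; the value at \<open>0\<close> is ignored. ``Infinitely many
  \<open>n\<close>, \<open>a \<in> P\<^sub>n\<close>'' counts pairs \<open>(n, a)\<close>.\<close>

definition W_approx :: "(nat \<Rightarrow> nat set) \<Rightarrow> (nat \<Rightarrow> real) \<Rightarrow> real set" where
  "W_approx P \<Psi> = {x \<in> {0..1}.
     infinite {(n, a). n \<ge> 1 \<and> a \<in> P n \<and> \<bar>x - real a / real n\<bar> < \<Psi> n}}"

definition uniform_random_subsets :: "'w measure \<Rightarrow> (nat \<Rightarrow> 'w \<Rightarrow> nat set) \<Rightarrow> bool" where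
  "uniform_random_subsets M P \<longleftrightarrow>
     prob_space.indep_vars M (\<lambda>n. count_space (Pow {1..n})) P {1..} \<and>
     (\<forall>n\<ge>1. distr M (count_space (Pow {1..n})) (P n) = uniform_count_measure (Pow {1..n}))"

text \<open>Rules out a value \<open>emeasure lebesgue (W_approx P \<Psi>) = 0\<close> caused by non-measurability.\<close>

lemma W_approx_borel: "W_approx P \<Psi> \<in> sets borel"
proof -
  define I where "I = (SIGMA n:{1..}. P n)"
  define B where "B = (\<lambda>p. {x::real. \<bar>x - real (snd p) / real (fst p)\<bar> < \<Psi> (fst p)})"
  have S: "{(n, a). n \<ge> 1 \<and> a \<in> P n \<and> \<bar>x - real a / real n\<bar> < \<Psi> n} = {p \<in> I. x \<in> B p}" for x
    by (auto simp: I_def B_def)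
  have inf: "infinite {p \<in> I. x \<in> B p} \<longleftrightarrow> (\<forall>F\<in>{F. finite F}. \<exists>p\<in>I - F. x \<in> B p)" for x
  proof
    assume inf: "infinite {p \<in> I. x \<in> B p}"
    show "\<forall>F\<in>{F. finite F}. \<exists>p\<in>I - F. x \<in> B p"
    proof
      fix F :: "(nat \<times> nat) set" assume "F \<in> {F. finite F}"
      then have "\<not> {p \<in> I. x \<in> B p} \<subseteq> F"
        using inf finite_subset by (metis mem_Collect_eq)
      then show "\<exists>p\<in>I - F. x \<in> B p" by blast
    qed
  next
    assume *: "\<forall>F\<in>{F. finite F}. \<exists>p\<in>I - F. x \<in> B p"
    show "infinite {p \<in> I. x \<in> B p}"
      using bspec[OF *, of "{p \<in> I. x \<in> B p}"] by blast
  qed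
  have eq: "W_approx P \<Psi> = {0..1} \<inter> (\<Inter>F\<in>{F. finite F}. \<Union>p\<in>I - F. B p)"
    unfolding W_approx_def S inf by blast
  have B: "B p \<in> sets borel" for p
    unfolding B_def by measurable
  have U: "(\<Union>p\<in>I - F. B p) \<in> sets borel" for F
    by (rule sets.countable_UN''[OF _ B]) auto
  have "(\<Inter>F\<in>{F. finite F}. \<Union>p\<in>I - F. B p) \<in> sets borel"
    using U by (intro sets.countable_INT'' countable_Collect_finite) auto
  then show ?thesis
    unfolding eq by (intro sets.Int) auto
qed

end

theory Submission
  imports Defs "HOL-Real_Asymp.Real_Asymp"
begin

text \<open>
  The convergence case is the Borel--Cantelli lemma. For divergence, let \<open>S\<^sub>k\<close> be the set of reduced
  fractions \<open>a/n\<close> with \<open>n \<le> 2\<^sup>k\<close> and \<open>a \<in> P\<^sub>n\<close>; it is \<open>4\<^sup>-\<^sup>k\<close>-separated. An interval \<open>I\<close> contains at least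
  \<open>|I| 4\<^sup>k / 16\<close> reduced fractions with \<open>n \<le> 2\<^sup>k\<close> once \<open>k\<close> is large, and by Chebyshev and Borel--Cantelli
  almost surely a quarter of them survive in \<open>S\<^sub>k\<close>, for all large \<open>k\<close> and simultaneously for all
  dyadic \<open>I\<close>. This single event, which does not mention \<open>\<Psi>\<close>, is all that is needed. Put
  \<open>\<psi>\<^sub>k = min (\<Psi>(2\<^sup>k)) 4\<^sup>-\<^sup>k\<close>, so that \<open>\<Sum> 4\<^sup>k \<psi>\<^sub>k = \<infinity>\<close>. Separation makes the \<open>\<psi>\<^sub>k\<close>-neighbourhoods of the
  \<open>S\<^sub>k\<close> quasi-independent on average in every dyadic interval, so their tail unions fill a fixed
  proportion of it. The complement of a tail union is compact, and hence null. Finally, an irrational \<open>x\<close>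
  lying in infinitely many of these neighbourhoods is approximated by infinitely many distinct pairs
  \<open>(n, a)\<close>, because \<open>\<psi>\<^sub>k \<rightarrow> 0\<close>.
\<close>

section \<open>Covering by neighbourhoods of separated sets\<close>

text \<open>Integrate \<open>2tZ - (tZ)\<^sup>2 \<le> 1\<close>, where \<open>Z\<close> counts the sets \<open>B p\<close> containing a point.\<close>

lemma measure_UN_ge_second_moment:
  fixes t :: real
  assumes fin: "finite X" and B: "\<And>p. p \<in> X \<Longrightarrow> B p \<in> fmeasurable M"
  shows "2 * t * (\<Sum>p\<in>X. measure M (B p)) - t\<^sup>2 * (\<Sum>p\<in>X. \<Sum>q\<in>X. measure M (B p \<inter> B q))
           \<le> measure M (\<Union>p\<in>X. B p)"
proof -
  define U where "U = (\<Union>p\<in>X. B p)"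
  define Z where "Z x = (\<Sum>p\<in>X. indicat_real (B p) x)" for x
  have U: "U \<in> fmeasurable M"
    unfolding U_def using fin B by (intro fmeasurable.finite_UN) auto
  have Z2: "(Z x)\<^sup>2 = (\<Sum>p\<in>X. \<Sum>q\<in>X. indicat_real (B p \<inter> B q) x)" for x
    by (simp add: Z_def power2_eq_square sum_product indicator_inter_arith)
  have int1: "integrable M (indicat_real A)" if "A \<in> fmeasurable M" for A
    using that by (auto simp: fmeasurable_def integrable_indicator_iff)
  have BB: "B p \<inter> B q \<in> fmeasurable M" if "p \<in> X" "q \<in> X" for p q
    using B that by (intro fmeasurable.Int) auto
  have "(\<integral>x. 2 * t * Z x - t\<^sup>2 * (Z x)\<^sup>2 \<partial>M) \<le> (\<integral>x. indicat_real U x \<partial>M)"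
  proof (rule integral_mono)
    show "integrable M (\<lambda>x. 2 * t * Z x - t\<^sup>2 * (Z x)\<^sup>2)"
      unfolding Z2 unfolding Z_def
      by (intro Bochner_Integration.integrable_diff integrable_mult_right Bochner_Integration.integrable_sum int1 B BB)
    show "integrable M (indicat_real U)" by (rule int1[OF U])
    fix x
    have "2 * (t * Z x) - (t * Z x)\<^sup>2 \<le> 1"
      using zero_le_power2[of "1 - t * Z x"] by (simp add: power2_eq_square algebra_simps)
    moreover have "Z x = 0" if "x \<notin> U"
      using that by (auto simp: Z_def U_def intro!: sum.neutral)
    ultimately show "2 * t * Z x - t\<^sup>2 * (Z x)\<^sup>2 \<le> indicat_real U x"
      by (cases "x \<in> U") (auto simp: power_mult_distrib algebra_simps)
  qed
  moreover have "(\<integral>x. 2 * t * Z x - t\<^sup>2 * (Z x)\<^sup>2 \<partial>M) =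
      2 * t * (\<Sum>p\<in>X. measure M (B p)) - t\<^sup>2 * (\<Sum>p\<in>X. \<Sum>q\<in>X. measure M (B p \<inter> B q))"
    unfolding Z2 unfolding Z_def
    using B BB
    by (subst Bochner_Integration.integral_diff)
       (auto intro!: integrable_mult_right Bochner_Integration.integrable_sum int1 sum.cong arg_cong2[of _ _ _ _ "(-)"]
         arg_cong[of _ _ "(*) _"] simp: Bochner_Integration.integral_sum int1 
         Int_absorb2 fmeasurableD sets.sets_into_space simp del: Bochner_Integration.integral_mult_right_zero)
  ultimately show ?thesis
    using U by (simp add: U_def Int_absorb2 fmeasurableD sets.sets_into_space)
qed

text \<open>Two points in a common cell of length \<delta> are less than \<delta> apart, so the cell
  index is injective on \<open>S\<close>. The summand 1 stays visible however short the interval is;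
  it is the source of the diagonal term in the second-moment estimate below.\<close>

lemma card_separated_le:
  fixes S :: "real set"
  assumes "S \<subseteq> {a..b}" "a \<le> b" "\<delta> > 0"
    and sep: "\<And>x y. x \<in> S \<Longrightarrow> y \<in> S \<Longrightarrow> x \<noteq> y \<Longrightarrow> \<delta> \<le> \<bar>x - y\<bar>"
  shows "real (card S) \<le> (b - a) / \<delta> + 1"
proof -
  define f where "f x = \<lfloor>(x - a) / \<delta>\<rfloor>" for x
  have "inj_on f S"
  proof (rule inj_onI, rule ccontr)
    fix x y assume xy: "x \<in> S" "y \<in> S" "f x = f y" "x \<noteq> y"
    have "\<bar>(x - a) / \<delta> - (y - a) / \<delta>\<bar> < 1"
      using xy(3) unfolding f_def by linarith
    moreover have "(x - a) / \<delta> - (y - a) / \<delta> = (x - y) / \<delta>"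
      by (simp add: diff_divide_distrib)
    ultimately show False
      using sep[OF xy(1,2,4)] assms(3) by (simp add: field_simps)
  qed
  moreover have "f ` S \<subseteq> {0..\<lfloor>(b - a) / \<delta>\<rfloor>}"
  proof
    fix y assume "y \<in> f ` S"
    then obtain x where x: "x \<in> S" "y = f x" by blast
    then have "a \<le> x" "x \<le> b" using assms(1) by auto
    then show "y \<in> {0..\<lfloor>(b - a) / \<delta>\<rfloor>}"
      using assms(3) x(2) by (auto simp: f_def intro!: floor_mono divide_right_mono)
  qed
  ultimately have "card S \<le> card {0..\<lfloor>(b - a) / \<delta>\<rfloor>}"
    by (intro card_inj_on_le) auto
  also have "real \<dots> = of_int \<lfloor>(b - a) / \<delta>\<rfloor> + 1"
    using assms(2,3) by simp
  also have "\<dots> \<le> (b - a) / \<delta> + 1" by simp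
  finally show ?thesis by simp
qed

text \<open>An elementary stand-in for the Lebesgue density theorem. Summing the density bound over
  the cells that meet \<open>K\<close>, all inside a neighbourhood of measure at most |K| + e, gives
  |K| <= (1 - c)(|K| + e) when c <= 1, and e is arbitrary. Compactness supplies one radius that
  keeps every ball around a point of \<open>K\<close> inside that neighbourhood.\<close>

lemma compact_null_if_dyadic_density_less_1:
  fixes K :: "real set" and c :: real
  assumes K: "compact K" "K \<subseteq> {0..1}" and c: "c > 0"
    and dens: "\<And>m i. i < 2 ^ m \<Longrightarrow>
      measure lborel (K \<inter> {real i / 2 ^ m<..real (i + 1) / 2 ^ m}) \<le> (1 - c) / 2 ^ m"
  shows "measure lborel K = 0"
proof -
  define I where "I m i = {real i / 2 ^ m<..real (i + 1) / 2 ^ m}" for m i :: nat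
  have KB: "K \<in> fmeasurable lborel"
    using K(1) by (simp add: fmeasurable_compact)
  have IB: "I m i \<in> fmeasurable lborel" for m i
    unfolding I_def by (rule fmeasurableI2[OF fmeasurable_cbox[of "real i / 2 ^ m" "real (i + 1) / 2 ^ m"]]) auto
  have mI: "measure lborel (I m i) = 1 / 2 ^ m" for m i
    by (simp add: I_def field_simps)
  have disj: "disjoint_family_on (I m) A" for m A
  proof (unfold disjoint_family_on_def, intro ballI impI)
    fix i j :: nat assume "i \<noteq> j"
    then have "real i + 1 \<le> real j \<or> real j + 1 \<le> real i" by linarith
    then show "I m i \<inter> I m j = {}"
      by (auto simp: I_def field_simps)
  qed
  have cover: "\<exists>i<2 ^ m. x \<in> I m i" if "x \<in> {0<..1}" for x m
  proof -
    \<comment> \<open>The cells are open on the left, so the index is the ceiling minus one; x > 0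
      keeps it nonnegative and x = 1 falls into the last cell.\<close>
    define i where "i = nat (\<lceil>x * 2 ^ m\<rceil> - 1)"
    have "x * 2 ^ m > 0" "x * 2 ^ m \<le> 2 ^ m" using that by auto
    moreover from this have "0 < \<lceil>x * 2 ^ m\<rceil>" by simp
    then have i: "real i = of_int \<lceil>x * 2 ^ m\<rceil> - 1" by (simp add: i_def)
    ultimately have "real i < x * 2 ^ m" "x * 2 ^ m \<le> real i + 1" by linarith+
    moreover from this \<open>x * 2 ^ m \<le> 2 ^ m\<close> have "real i < 2 ^ m" by linarith
    then have "i < 2 ^ m" by (metis of_nat_less_iff of_nat_numeral of_nat_power)
    ultimately show ?thesis
      by (intro exI[of _ i]) (auto simp: I_def field_simps)
  qed
  \<comment> \<open>Fine dyadic intervals meeting \<open>K\<close> stay inside an open \<open>V \<supseteq> K\<close> of almost the same measure.\<close>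
  have "c * measure lborel K \<le> 0 + e" if "e > 0" for e
  proof -
    obtain V where V: "open V" "K \<subseteq> V" "V \<in> fmeasurable lborel" "measure lborel V \<le> measure lborel K + e"
    proof -
      obtain T where T: "open T" "K \<subseteq> T" "T - K \<in> lmeasurable" "emeasure lebesgue (T - K) < ennreal e"
        using sets_lebesgue_outer_open[of K e] KB \<open>e > 0\<close> by auto
      have TK: "T - K \<in> sets lborel" using T(1) KB by auto
      have "emeasure lborel (T - K) < ennreal e"
        using T(4) TK by simp
      moreover from this have TKf: "T - K \<in> fmeasurable lborel"
        using TK by (auto simp: fmeasurable_def intro: order_less_trans)
      ultimately have le: "measure lborel (T - K) < e"
        using \<open>e > 0\<close> by (simp add: emeasure_eq_measure2 ennreal_less_iff)
      have eq: "T = K \<union> (T - K)" using T(2) by auto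
      have "T \<in> fmeasurable lborel"
        by (subst eq) (intro fmeasurable.Un KB TKf)
      moreover have "measure lborel T \<le> measure lborel K + measure lborel (T - K)"
        by (subst eq) (intro measure_Un_le fmeasurableD KB TKf)
      ultimately show ?thesis using that[of T] T(1,2) le by simp
    qed
    obtain d where d: "d > 0" "\<And>x. x \<in> K \<Longrightarrow> ball x d \<subseteq> V"
      using Heine_Borel_lemma[of K "{V}"] V(1,2) K(1) by auto
    obtain m where m: "(1/2::real) ^ m < d"
      using real_arch_pow_inv[of d "1/2"] d by auto
    define J where "J = {i. i < 2 ^ m \<and> K \<inter> I m i \<noteq> {}}"
    have J: "finite J" "J \<subseteq> {..<2^m}" by (auto simp: J_def)
    have sub: "(\<Union>i\<in>J. I m i) \<subseteq> V"
    proof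
      fix y assume "y \<in> (\<Union>i\<in>J. I m i)"
      then obtain i x where ix: "y \<in> I m i" "x \<in> K" "x \<in> I m i" by (auto simp: J_def)
      then have "\<bar>x - y\<bar> < 1 / 2 ^ m" by (auto simp: I_def abs_if add_divide_distrib)
      then have "y \<in> ball x d" using m by (simp add: dist_real_def power_one_over)
      then show "y \<in> V" using d(2) ix(2) by blast
    qed
    \<comment> \<open>The point 0 lies in none of the half-open cells.\<close>
    have "measure lborel K = measure lborel (K - {0})"
      by (rule measure_eq_AE) (use KB AE_lborel_singleton[of 0] in \<open>auto elim: AE_mp\<close>)
    also have "\<dots> \<le> measure lborel (\<Union>i\<in>J. K \<inter> I m i)"
    proof (rule measure_mono_fmeasurable)
      show "K - {0} \<subseteq> (\<Union>i\<in>J. K \<inter> I m i)"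
      proof
        fix x assume x: "x \<in> K - {0}"
        then obtain i where "i < 2 ^ m" "x \<in> I m i" using cover[of x m] K(2) by force
        then show "x \<in> (\<Union>i\<in>J. K \<inter> I m i)" using x by (auto simp: J_def)
      qed
      show "(\<Union>i\<in>J. K \<inter> I m i) \<in> fmeasurable lborel"
        using J KB IB by (intro fmeasurable.finite_UN fmeasurable.Int) auto
    qed (use KB in auto)
    also have "\<dots> \<le> (\<Sum>i\<in>J. measure lborel (K \<inter> I m i))"
      using J KB IB by (intro measure_UNION_le) auto
    also have "\<dots> \<le> (\<Sum>i\<in>J. (1 - c) * measure lborel (I m i))"
      using J dens[folded I_def] by (intro sum_mono) (auto simp: mI)
    also have "\<dots> = (1 - c) * measure lborel (\<Union>i\<in>J. I m i)"
      using J IB disj[of m J]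
      by (subst measure_finite_Union) (auto simp: sum_distrib_left fmeasurable_def less_top[symmetric])
    finally have *: "measure lborel K \<le> (1 - c) * measure lborel (\<Union>i\<in>J. I m i)" .
    have **: "measure lborel (\<Union>i\<in>J. I m i) \<le> measure lborel K + e"
      using measure_mono_fmeasurable[OF sub _ V(3)] V(4) J IB by force
    show ?thesis
    proof (cases "c \<le> 1")
      case True
      then have "measure lborel K \<le> (1 - c) * (measure lborel K + e)"
        using * ** by (meson diff_ge_0_iff_ge mult_left_mono order_trans)
      moreover have "c * e \<ge> 0" using c that by simp
      ultimately show ?thesis by (simp add: algebra_simps)
    next
      case False
      \<comment> \<open>Now 1 - c is negative, and the density bound alone forces \<open>K\<close>
        to be null.\<close>
      then have "(1 - c) * measure lborel (\<Union>i\<in>J. I m i) \<le> 0"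
        by (intro mult_nonpos_nonneg) auto
      then have "measure lborel K = 0" using * measure_nonneg[of lborel K] by linarith
      then show ?thesis using that by simp
    qed
  qed
  then have "c * measure lborel K \<le> 0" by (rule field_le_epsilon)
  then show ?thesis using c measure_nonneg[of lborel K] by (simp add: mult_le_0_iff)
qed

text \<open>The second-moment bound is applied to the balls of finitely many levels, of total weight
  A = sum of 4^k \<psi>(k). With L = v - u, density makes the first moment at least 2cLA, and
  separation makes the second at most 56LA^2. Their quotient bounds the covered measure by a
  multiple of L that depends on neither \<psi> nor \<open>m\<close>.\<close>

lemma dense_separated_cover:
  fixes S :: "nat \<Rightarrow> real set" and \<psi> :: "nat \<Rightarrow> real"
  assumes fin: "\<And>k. finite (S k)"
    and sep: "\<And>k x y. x \<in> S k \<Longrightarrow> y \<in> S k \<Longrightarrow> x \<noteq> y \<Longrightarrow> 1 / 4 ^ k \<le> \<bar>x - y\<bar>"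
    and uv: "u < v" and c: "c > 0"
    and dens: "\<forall>\<^sub>F k in sequentially. c * (v - u) * 4 ^ k \<le> real (card (S k \<inter> {u<..v}))"
    and psi0: "\<And>k. 0 \<le> \<psi> k" and psi1: "\<And>k. \<psi> k \<le> 1 / 4 ^ k"
    and div: "\<not> summable (\<lambda>k. 4 ^ k * \<psi> k)"
  shows "c\<^sup>2 / 28 * (v - u) \<le>
    measure lborel ({u<..v} \<inter> (\<Union>k\<in>{m..}. \<Union>s\<in>S k. {s - \<psi> k<..<s + \<psi> k}))"
proof -
  define L where "L = v - u"
  have L: "L > 0" using uv by (simp add: L_def)
  define F where "F k = S k \<inter> {u<..v}" for k
  define B where "B p = {snd p - \<psi> (fst p)<..<snd p + \<psi> (fst p)}" for p
  define a where "a k = 4 ^ k * \<psi> k" for k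
  have finF: "finite (F k)" for k using fin by (simp add: F_def)
  have a: "0 \<le> a k" "a k \<le> 1" for k
    using psi0[of k] psi1[of k] by (auto simp: a_def field_simps)
  have Bf: "B p \<in> fmeasurable lborel" for p
    unfolding B_def
    by (rule fmeasurableI2[OF fmeasurable_cbox[of "snd p - \<psi> (fst p)" "snd p + \<psi> (fst p)"]]) auto
  have mB: "measure lborel (B p) = 2 * \<psi> (fst p)" for p
    using psi0[of "fst p"] by (simp add: B_def)
  \<comment> \<open>Three demands on the first level \<open>m0\<close>: enough centres; L 4^k at
    least 1, which absorbs the summand 1 of the packing bound; and an overhang 2/4^m0 past the two
    endpoints that costs less than half of the gain c^2 L / 14.\<close>
  have "\<forall>\<^sub>F k in sequentially. c * L * 4 ^ k \<le> real (card (F k)) \<and> 1 \<le> L * 4 ^ k \<and> 1 / 4 ^ k < c\<^sup>2 / 28 * L / 2"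
  proof (intro eventually_conj)
    show "\<forall>\<^sub>F k in sequentially. c * L * 4 ^ k \<le> real (card (F k))"
      using dens by (simp add: L_def F_def)
    have lim: "((\<lambda>k. 1 / 4 ^ k) \<longlongrightarrow> (0::real)) sequentially"
      by real_asymp
    show "\<forall>\<^sub>F k in sequentially. 1 / 4 ^ k < c\<^sup>2 / 28 * L / 2"
      by (rule order_tendstoD(2)[OF lim]) (use c L in auto)
    have "\<forall>\<^sub>F k in sequentially. 1 / 4 ^ k < L"
      by (rule order_tendstoD(2)[OF lim]) (use c L in auto)
    then show "\<forall>\<^sub>F k in sequentially. 1 \<le> L * 4 ^ k"
      by eventually_elim (auto simp: field_simps)
  qed
  then obtain m0 where m0: "\<And>k. k \<ge> m0 \<Longrightarrow> c * L * 4 ^ k \<le> real (card (F k))"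
      "\<And>k. k \<ge> m0 \<Longrightarrow> 1 \<le> L * 4 ^ k" "1 / 4 ^ m0 < c\<^sup>2 / 28 * L / 2" "m0 \<ge> m"
    by (force simp: eventually_sequentially dest: spec[of _ "max m _"])
  \<comment> \<open>A tail of a divergent series still diverges, so a finite block of weight at
    least 1 exists. Weight at least 1 lets the linear diagonal term be absorbed into A^2.\<close>
  obtain n where n: "1 \<le> (\<Sum>k\<in>{m0..<n}. a k)"
  proof (rule ccontr)
    assume "\<not> thesis"
    then have *: "(\<Sum>k\<in>{m0..<n}. a k) \<le> 1" for n using that by (meson linear)
    have "(\<Sum>k\<le>n. a (k + m0)) \<le> 1" for n
      using *[of "Suc n + m0"] sum.shift_bounds_nat_ivl[of a 0 m0 "Suc n"]
      by (simp add: atLeast0LessThan lessThan_Suc_atMost)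
    then have "summable (\<lambda>k. a (k + m0))"
      by (intro bounded_imp_summable[of _ 1] a)
    then have "summable a" by (simp only: summable_iff_shift)
    then show False using div by (simp add: a_def[abs_def])
  qed
  define R where "R = {m0..<n}"
  define A where "A = (\<Sum>k\<in>R. a k)"
  have A: "A \<ge> 1" using n by (simp add: A_def R_def)
  define X where "X = Sigma R F"
  have finX: "finite X" using finF by (simp add: X_def R_def)
  define G where "G j k = (\<Sum>s\<in>F j. \<Sum>t\<in>F k. measure lborel (B (j, s) \<inter> B (k, t)))" for j k
  \<comment> \<open>The diagonal contribution, not covered by quasi-independence: a ball of level \<open>j \<le> k\<close> may meet up
    to three balls of level \<open>k\<close> however small its radius.\<close>
  define h where "h j k = (if j \<le> k then 4 ^ j * \<psi> k else 0)" for j k :: nat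
  have Gsym: "G j k = G k j" for j k
    unfolding G_def by (subst sum.swap) (simp add: Int_commute)
  have cardF: "real (card (F j)) \<le> 2 * L * 4 ^ j" if "j \<ge> m0" for j
  proof -
    have "real (card (F j)) \<le> (v - u) / (1 / 4 ^ j) + 1"
      using uv by (intro card_separated_le) (auto simp: F_def intro: sep)
    also have "\<dots> = L * 4 ^ j + 1" by (simp add: L_def)
    finally show ?thesis using m0(2)[OF that] by linarith
  qed
  have G1: "G j k \<le> 8 * L * a j * a k + 12 * L * (4 ^ j * \<psi> k)" if jk: "j \<ge> m0" "j \<le> k" for j k
  proof -
    \<comment> \<open>Only centres of level k within \<psi>(j) + \<psi>(k) of s matter, and they are
      4^-k-separated. Packing gives 2 \<psi>(j) 4^k, the share expected under independence, plus 2
      a(k) + 1, which is at most 3.\<close>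
    have inner: "(\<Sum>t\<in>F k. measure lborel (B (j, s) \<inter> B (k, t))) \<le> (2 * \<psi> j * 4 ^ k + 3) * (2 * \<psi> k)"
      if "s \<in> F j" for s
    proof -
      define r where "r = \<psi> j + \<psi> k"
      define H where "H = F k \<inter> {s - r..s + r}"
      have "(\<Sum>t\<in>F k. measure lborel (B (j, s) \<inter> B (k, t))) = (\<Sum>t\<in>H. measure lborel (B (j, s) \<inter> B (k, t)))"
      proof (rule sum.mono_neutral_right)
        show "\<forall>t\<in>F k - H. measure lborel (B (j, s) \<inter> B (k, t)) = 0"
        proof
          fix t assume "t \<in> F k - H"
          then have "B (j, s) \<inter> B (k, t) = {}" by (auto simp: H_def B_def r_def)
          then show "measure lborel (B (j, s) \<inter> B (k, t)) = 0" by simp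
        qed
      qed (auto simp: H_def finF)
      also have "\<dots> \<le> (\<Sum>t\<in>H. 2 * \<psi> k)"
      proof (rule sum_mono)
        fix t
        have "measure lborel (B (j, s) \<inter> B (k, t)) \<le> measure lborel (B (k, t))"
          using Bf by (intro measure_mono_fmeasurable sets.Int fmeasurableD) auto
        then show "measure lborel (B (j, s) \<inter> B (k, t)) \<le> 2 * \<psi> k" by (simp add: mB)
      qed
      also have "\<dots> = real (card H) * (2 * \<psi> k)" by simp
      also have "\<dots> \<le> (2 * \<psi> j * 4 ^ k + 3) * (2 * \<psi> k)"
      proof (rule mult_right_mono)
        have "real (card H) \<le> ((s + r) - (s - r)) / (1 / 4 ^ k) + 1"
          using psi0[of j] psi0[of k]
          by (intro card_separated_le) (auto simp: H_def F_def r_def intro: sep)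
        also have "\<dots> = 2 * \<psi> j * 4 ^ k + 2 * a k + 1"
          by (simp add: r_def a_def algebra_simps)
        finally show "real (card H) \<le> 2 * \<psi> j * 4 ^ k + 3" using a(2)[of k] by simp
      qed (use psi0 in auto)
      finally show ?thesis .
    qed
    have "G j k \<le> (\<Sum>s\<in>F j. (2 * \<psi> j * 4 ^ k + 3) * (2 * \<psi> k))"
      unfolding G_def by (intro sum_mono inner)
    also have "\<dots> = real (card (F j)) * ((2 * \<psi> j * 4 ^ k + 3) * (2 * \<psi> k))" by simp
    also have "\<dots> \<le> 2 * L * 4 ^ j * ((2 * \<psi> j * 4 ^ k + 3) * (2 * \<psi> k))"
      using psi0 jk by (intro mult_right_mono cardF) auto
    also have "\<dots> = 8 * L * a j * a k + 12 * L * (4 ^ j * \<psi> k)"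
      by (simp add: a_def algebra_simps)
    finally show ?thesis .
  qed
  have h0: "h j k \<ge> 0" for j k using psi0 by (auto simp: h_def)
  have G: "G j k \<le> 8 * L * (a j * a k) + 12 * L * (h j k + h k j)" if "j \<in> R" "k \<in> R" for j k
  proof (cases "j \<le> k")
    case True
    have "12 * L * h j k \<le> 12 * L * (h j k + h k j)" using L h0 by (intro mult_left_mono) auto
    then show ?thesis using G1[of j k] that True by (simp add: h_def R_def mult.assoc)
  next
    case False
    have "12 * L * h k j \<le> 12 * L * (h j k + h k j)" using L h0 by (intro mult_left_mono) auto
    then show ?thesis using G1[of k j] that False Gsym[of j k]
      by (simp add: h_def R_def mult.assoc mult.left_commute mult.commute)
  qed
  \<comment> \<open>The levels j <= k form a geometric series dominated by its last term, so the
    whole diagonal contribution is linear in A.\<close>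
  have hsum: "(\<Sum>j\<in>R. h j k) \<le> 2 * a k" for k
  proof -
    have geo: "(\<Sum>j\<le>k. 4 ^ j) \<le> 2 * (4::real) ^ k"
    proof (induction k)
      case (Suc k)
      have "(0::real) \<le> 4 ^ k" by simp
      with Suc show ?case by (simp only: sum.atMost_Suc power_Suc)
    qed simp
    have "(\<Sum>j\<in>R. h j k) = (\<Sum>j\<in>R \<inter> {..k}. 4 ^ j * \<psi> k)"
      unfolding h_def by (subst sum.inter_restrict) (auto simp: R_def)
    also have "\<dots> \<le> (\<Sum>j\<le>k. 4 ^ j * \<psi> k)"
      using psi0 by (intro sum_mono2) auto
    also have "\<dots> = (\<Sum>j\<le>k. 4 ^ j) * \<psi> k" by (simp add: sum_distrib_right)
    also have "\<dots> \<le> 2 * 4 ^ k * \<psi> k" using geo psi0 by (intro mult_right_mono) auto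
    finally show ?thesis by (simp add: a_def)
  qed
  have sumX: "(\<Sum>p\<in>X. g p) = (\<Sum>j\<in>R. \<Sum>s\<in>F j. g (j, s))" for g :: "nat \<times> real \<Rightarrow> real"
    using sum.Sigma[of R F "\<lambda>j s. g (j, s)"] finF by (simp add: X_def R_def)
  have "(\<Sum>p\<in>X. \<Sum>q\<in>X. measure lborel (B p \<inter> B q)) = (\<Sum>j\<in>R. \<Sum>k\<in>R. G j k)"
  proof -
    have "(\<Sum>p\<in>X. \<Sum>q\<in>X. measure lborel (B p \<inter> B q)) =
        (\<Sum>j\<in>R. \<Sum>s\<in>F j. \<Sum>k\<in>R. \<Sum>t\<in>F k. measure lborel (B (j, s) \<inter> B (k, t)))"
      by (simp only: sumX)
    also have "\<dots> = (\<Sum>j\<in>R. \<Sum>k\<in>R. G j k)"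
      unfolding G_def by (intro sum.cong refl sum.swap)
    finally show ?thesis .
  qed
  also have "\<dots> \<le> (\<Sum>j\<in>R. \<Sum>k\<in>R. 8 * L * (a j * a k) + 12 * L * (h j k + h k j))"
    by (intro sum_mono G)
  also have "\<dots> = 8 * L * (\<Sum>j\<in>R. \<Sum>k\<in>R. a j * a k) + 12 * L * ((\<Sum>j\<in>R. \<Sum>k\<in>R. h j k) + (\<Sum>j\<in>R. \<Sum>k\<in>R. h k j))"
    by (simp add: sum.distrib sum_distrib_left distrib_left)
  also have "(\<Sum>j\<in>R. \<Sum>k\<in>R. h j k) = (\<Sum>j\<in>R. \<Sum>k\<in>R. h k j)" by (rule sum.swap)
  also have "(\<Sum>j\<in>R. \<Sum>k\<in>R. a j * a k) = A * A" by (simp add: A_def sum_product)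
  also have "8 * L * (A * A) + 12 * L * ((\<Sum>j\<in>R. \<Sum>k\<in>R. h k j) + (\<Sum>j\<in>R. \<Sum>k\<in>R. h k j))
      \<le> 8 * L * (A * A) + 12 * L * (2 * A + 2 * A)"
  proof -
    have "(\<Sum>j\<in>R. \<Sum>k\<in>R. h k j) \<le> (\<Sum>j\<in>R. 2 * a j)" by (intro sum_mono hsum)
    also have "\<dots> = 2 * A" by (simp add: A_def sum_distrib_left)
    finally show ?thesis using L by (intro add_left_mono mult_left_mono add_mono) auto
  qed
  also have "\<dots> \<le> 56 * L * A\<^sup>2"
  proof -
    have "48 * L * A \<le> 48 * L * (A * A)" using A L by simp
    then show ?thesis by (simp add: power2_eq_square mult_ac)
  qed
  finally have second: "(\<Sum>p\<in>X. \<Sum>q\<in>X. measure lborel (B p \<inter> B q)) \<le> 56 * L * A\<^sup>2" .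
  have first: "2 * c * L * A \<le> (\<Sum>p\<in>X. measure lborel (B p))"
  proof -
    have "2 * c * L * A = (\<Sum>k\<in>R. (c * L * 4 ^ k) * (2 * \<psi> k))"
      by (simp add: A_def a_def sum_distrib_left mult_ac)
    also have "\<dots> \<le> (\<Sum>k\<in>R. real (card (F k)) * (2 * \<psi> k))"
      using psi0 by (intro sum_mono mult_right_mono m0(1)) (auto simp: R_def)
    also have "\<dots> = (\<Sum>k\<in>R. \<Sum>s\<in>F k. measure lborel (B (k, s)))" by (simp add: mB)
    also have "\<dots> = (\<Sum>p\<in>X. measure lborel (B p))"
      by (simp only: sumX)
    finally show ?thesis .
  qed
  \<comment> \<open>The maximiser of 2t(2cLA) - t^2 (56LA^2).\<close>
  define t where "t = c / (28 * A)"
  have t: "t > 0" using c A by (simp add: t_def)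
  have "c\<^sup>2 / 14 * L = 2 * t * (2 * c * L * A) - t\<^sup>2 * (56 * L * A\<^sup>2)"
    using A by (simp add: t_def field_simps power2_eq_square)
  also have "\<dots> \<le> 2 * t * (\<Sum>p\<in>X. measure lborel (B p)) -
      t\<^sup>2 * (\<Sum>p\<in>X. \<Sum>q\<in>X. measure lborel (B p \<inter> B q))"
    using t by (intro diff_mono mult_left_mono first second) auto
  also have "\<dots> \<le> measure lborel (\<Union>p\<in>X. B p)"
    by (intro measure_UN_ge_second_moment finX Bf)
  also have "\<dots> \<le> measure lborel ({u<..v} \<inter> (\<Union>p\<in>X. B p)) + 2 / 4 ^ m0"
  proof -
    define \<epsilon> :: real where "\<epsilon> = 1 / 4 ^ m0"
    have eps: "\<epsilon> > 0" by (simp add: \<epsilon>_def)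
    have Uf: "(\<Union>p\<in>X. B p) \<in> fmeasurable lborel"
      using finX Bf by (intro fmeasurable.finite_UN) auto
    have sm: "\<psi> k \<le> \<epsilon>" if "k \<ge> m0" for k
      using psi1[of k] power_increasing[OF that, of "4::real"] unfolding \<epsilon>_def
      by (smt (verit) frac_le zero_less_power)
    \<comment> \<open>Centres lie in (u, v] and radii are at most \<epsilon>, so the balls leave the
      interval only through two end strips of length \<epsilon>.\<close>
    have sub: "(\<Union>p\<in>X. B p) \<subseteq> ({u<..v} \<inter> (\<Union>p\<in>X. B p)) \<union> ({u - \<epsilon>..u} \<union> {v..v + \<epsilon>})"
    proof
      fix x assume x: "x \<in> (\<Union>p\<in>X. B p)"
      then obtain k s where ks: "k \<in> R" "s \<in> F k" "x \<in> B (k, s)" by (auto simp: X_def)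
      then have "u - \<epsilon> < x" "x < v + \<epsilon>" using sm[of k] by (auto simp: R_def F_def B_def)
      then show "x \<in> ({u<..v} \<inter> (\<Union>p\<in>X. B p)) \<union> ({u - \<epsilon>..u} \<union> {v..v + \<epsilon>})"
        using x by auto
    qed
    have f1: "{u<..v} \<inter> (\<Union>p\<in>X. B p) \<in> fmeasurable lborel"
      by (rule fmeasurableI2[OF Uf]) (use Uf in auto)
    have f2: "{u - \<epsilon>..u} \<union> {v..v + \<epsilon>} \<in> fmeasurable lborel"
      by (intro fmeasurable.Un) (auto simp: fmeasurable_compact)
    have "measure lborel (\<Union>p\<in>X. B p) \<le> measure lborel (({u<..v} \<inter> (\<Union>p\<in>X. B p)) \<union> ({u - \<epsilon>..u} \<union> {v..v + \<epsilon>}))"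
      using Uf by (intro measure_mono_fmeasurable sub fmeasurable.Un f1 f2) auto
    also have "\<dots> \<le> measure lborel ({u<..v} \<inter> (\<Union>p\<in>X. B p)) + measure lborel ({u - \<epsilon>..u} \<union> {v..v + \<epsilon>})"
      using f1 f2 by (intro measure_Un_le) auto
    also have "measure lborel ({u - \<epsilon>..u} \<union> {v..v + \<epsilon>}) \<le> measure lborel {u - \<epsilon>..u} + measure lborel {v..v + \<epsilon>}"
      by (intro measure_Un_le) auto
    also have "\<dots> = 2 / 4 ^ m0" using eps by (simp add: \<epsilon>_def)
    finally show ?thesis by simp
  qed
  also have "measure lborel ({u<..v} \<inter> (\<Union>p\<in>X. B p)) \<le>
      measure lborel ({u<..v} \<inter> (\<Union>k\<in>{m..}. \<Union>s\<in>S k. {s - \<psi> k<..<s + \<psi> k}))"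
  proof (rule measure_mono_fmeasurable)
    show "{u<..v} \<inter> (\<Union>p\<in>X. B p) \<subseteq> {u<..v} \<inter> (\<Union>k\<in>{m..}. \<Union>s\<in>S k. {s - \<psi> k<..<s + \<psi> k})"
      using m0(4) by (fastforce simp: X_def R_def F_def B_def)
    show "{u<..v} \<inter> (\<Union>p\<in>X. B p) \<in> sets lborel"
      using finX Bf by (auto simp: B_def)
    show "{u<..v} \<inter> (\<Union>k\<in>{m..}. \<Union>s\<in>S k. {s - \<psi> k<..<s + \<psi> k}) \<in> fmeasurable lborel"
    proof (rule fmeasurableI2[OF fmeasurable_cbox[of u v]])
      have "open (\<Union>k\<in>{m..}. \<Union>s\<in>S k. {s - \<psi> k<..<s + \<psi> k})"
        by (intro open_UN ballI open_greaterThanLessThan)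
      then show "{u<..v} \<inter> (\<Union>k\<in>{m..}. \<Union>s\<in>S k. {s - \<psi> k<..<s + \<psi> k}) \<in> sets lborel"
        by auto
    qed auto
  qed
  finally show ?thesis using m0(3) by (simp add: L_def algebra_simps)
qed

section \<open>Counting reduced fractions in an interval\<close>

text \<open>Pairs rather than values: 1/2 and 2/4 count separately, which makes the cardinality a
  plain sum over denominators.\<close>

definition frac_pairs :: "real \<Rightarrow> real \<Rightarrow> nat \<Rightarrow> (nat \<times> nat) set" where
  "frac_pairs u v N = (SIGMA n:{1..N}. {a. u * real n < real a \<and> real a \<le> v * real n})"

lemma card_nat_Ioc:
  fixes x y :: real
  assumes "0 \<le> x" "x \<le> y"
  shows "finite {a::nat. x < real a \<and> real a \<le> y}"
    and "\<bar>real (card {a::nat. x < real a \<and> real a \<le> y}) - (y - x)\<bar> \<le> 1"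
proof -
  have eq: "{a::nat. x < real a \<and> real a \<le> y} = {nat \<lfloor>x\<rfloor><..nat \<lfloor>y\<rfloor>}"
    using assms by (auto simp: le_nat_floor) (linarith+)
  show "finite {a::nat. x < real a \<and> real a \<le> y}" by (simp add: eq)
  have "real (card {a::nat. x < real a \<and> real a \<le> y}) = real_of_int \<lfloor>y\<rfloor> - real_of_int \<lfloor>x\<rfloor>"
    unfolding eq using assms floor_mono[of x y] by (simp add: of_nat_diff nat_mono)
  then show "\<bar>real (card {a::nat. x < real a \<and> real a \<le> y}) - (y - x)\<bar> \<le> 1"
    by linarith
qed

text \<open>Each denominator n admits (v - u) n numerators up to an error of 1. In the upper bound,
  the linear term (v - u) N / 2 of the Gauss sum is absorbed into a second N.\<close>

lemma card_frac_pairs: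
  assumes "0 \<le> u" "u \<le> v" "v \<le> 1"
  shows "finite (frac_pairs u v N)"
    and "(v - u) * (real N)\<^sup>2 / 2 - real N \<le> real (card (frac_pairs u v N))"
    and "real (card (frac_pairs u v N)) \<le> (v - u) * (real N)\<^sup>2 / 2 + 2 * real N"
proof -
  define D where "D n = {a::nat. u * real n < real a \<and> real a \<le> v * real n}" for n :: nat
  have D: "finite (D n)" "\<bar>real (card (D n)) - (v - u) * real n\<bar> \<le> 1" for n
    using card_nat_Ioc[of "u * real n" "v * real n"] assms
    by (auto simp: D_def mult_right_mono left_diff_distrib)
  have eq: "frac_pairs u v N = Sigma {1..N} D" unfolding frac_pairs_def D_def ..
  show "finite (frac_pairs u v N)" using D by (simp add: eq)
  have card: "real (card (frac_pairs u v N)) = (\<Sum>n=1..N. real (card (D n)))"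
    using D(1) by (simp add: eq card_SigmaI)
  have gauss: "(\<Sum>n=1..N. real n) = real N * (real N + 1) / 2"
    by (induction N) (auto simp: field_simps)
  have "(\<Sum>n=1..N. (v - u) * real n - 1) \<le> real (card (frac_pairs u v N))"
    unfolding card using D(2) by (intro sum_mono) (smt (verit))
  also have "(\<Sum>n=1..N. (v - u) * real n - 1) = (v - u) * (real N * (real N + 1) / 2) - real N"
    by (simp only: sum_subtractf gauss flip: sum_distrib_left) simp
  finally have "(v - u) * (real N * (real N + 1) / 2) - real N \<le> real (card (frac_pairs u v N))" .
  moreover have "(v - u) * (real N)\<^sup>2 / 2 \<le> (v - u) * (real N * (real N + 1) / 2)"
    using assms by (simp add: power2_eq_square mult_left_mono)
  ultimately show "(v - u) * (real N)\<^sup>2 / 2 - real N \<le> real (card (frac_pairs u v N))" by linarith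
  have "real (card (frac_pairs u v N)) \<le> (\<Sum>n=1..N. (v - u) * real n + 1)"
    unfolding card using D(2) by (intro sum_mono) (smt (verit))
  also have "(\<Sum>n=1..N. (v - u) * real n + 1) = (v - u) * (real N * (real N + 1) / 2) + real N"
    by (simp only: sum.distrib gauss flip: sum_distrib_left) simp
  also have "\<dots> = (v - u) * (real N)\<^sup>2 / 2 + (v - u) * (real N / 2) + real N"
    by (simp add: power2_eq_square algebra_simps add_divide_distrib)
  also have "(v - u) * (real N / 2) \<le> 1 * real N"
    using assms by (intro mult_mono) auto
  finally show "real (card (frac_pairs u v N)) \<le> (v - u) * (real N)\<^sup>2 / 2 + 2 * real N" by simp
qed

section \<open>Sieving out the pairs with a common factor\<close>

text \<open>The sieve needs a bound strictly below 1. Telescoping 1/d^2 <= 1/(d-1) - 1/d from d = 2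
  would give only 1; keeping the term 1/4 and telescoping from d = 3 gives 1/4 + 1/2.\<close>

lemma sum_inverse_squares_from_2_le: "(\<Sum>d=2..N. 1 / (real d)\<^sup>2) \<le> 3 / 4"
proof -
  have "(\<Sum>d=2..Suc (Suc N). 1 / (real d)\<^sup>2) \<le> 3 / 4 - 1 / real (Suc (Suc N))" for N
  proof (induction N)
    case (Suc N)
    have "1 / (real (Suc (Suc (Suc N))))\<^sup>2 \<le> 1 / real (Suc (Suc N)) - 1 / real (Suc (Suc (Suc N)))"
    proof -
      have "1 / (x + 1)\<^sup>2 \<le> 1 / x - 1 / (x + 1)" if "x > 0" for x :: real
      proof -
        have "1 / (x + 1)\<^sup>2 \<le> 1 / (x * (x + 1))"
          using that by (intro divide_left_mono) (auto simp: power2_eq_square)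
        also have "\<dots> = 1 / x - 1 / (x + 1)" using that by (simp add: field_simps)
        finally show ?thesis .
      qed
      from this[of "real (Suc (Suc N))"] show ?thesis by (simp add: add_ac)
    qed
    then show ?case using Suc by simp
  qed (simp add: numeral_2_eq_2)
  from this[of N] have "(\<Sum>d=2..Suc (Suc N). 1 / (real d)\<^sup>2) \<le> 3 / 4"
    by (rule order_trans) simp
  moreover have "(\<Sum>d=2..N. 1 / (real d)\<^sup>2) \<le> (\<Sum>d=2..Suc (Suc N). 1 / (real d)\<^sup>2)"
    by (rule sum_mono2) auto
  ultimately show ?thesis by linarith
qed

lemma sum_inverse_from_2_le_ln:
  assumes "N \<ge> 1"
  shows "(\<Sum>d=2..N. 1 / real d) \<le> ln (real N)"
  using assms
proof (induction N rule: dec_induct)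
  case (step N)
  have "ln (real N / real (Suc N)) \<le> real N / real (Suc N) - 1"
    using step by (intro ln_le_minus_one) auto
  also have "\<dots> = - (1 / real (Suc N))" by (simp add: field_simps)
  finally have "1 / real (Suc N) \<le> ln (real (Suc N)) - ln (real N)"
    using step by (simp add: ln_div)
  moreover have "(\<Sum>d=2..Suc N. 1 / real d) = (\<Sum>d=2..N. 1 / real d) + 1 / real (Suc N)"
    using step by simp
  ultimately show ?case using step.IH by linarith
qed simp

definition coprime_pairs :: "real \<Rightarrow> real \<Rightarrow> nat \<Rightarrow> (nat \<times> nat) set" where
  "coprime_pairs u v N = {(n, a) \<in> frac_pairs u v N. coprime n a}"

lemma finite_coprime_pairs:
  "0 \<le> u \<Longrightarrow> u \<le> v \<Longrightarrow> v \<le> 1 \<Longrightarrow> finite (coprime_pairs u v N)"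
  by (rule finite_subset[OF _ card_frac_pairs(1)]) (auto simp: coprime_pairs_def)

text \<open>Dividing a pair by its gcd d keeps the value of the fraction, hence the interval, and
  brings the denominator down to at most N div d.\<close>

lemma noncoprime_pairs_subset:
  "frac_pairs u v N - coprime_pairs u v N \<subseteq>
     (\<Union>d\<in>{2..N}. (\<lambda>(n, a). (d * n, d * a)) ` frac_pairs u v (N div d))"
proof
  fix p assume p: "p \<in> frac_pairs u v N - coprime_pairs u v N"
  obtain n a where na: "p = (n, a)" by (cases p)
  define d where "d = gcd n a"
  have n: "1 \<le> n" "n \<le> N" "u * real n < real a" "real a \<le> v * real n" and "\<not> coprime n a"
    using p by (auto simp: na frac_pairs_def coprime_pairs_def)
  then have d: "d \<noteq> 1" "d > 0" "d \<le> n"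
    by (auto simp: d_def coprime_iff_gcd_eq_1 intro!: gcd_le1_nat)
  obtain n' a' where eq: "n = d * n'" "a = d * a'"
    by (metis d_def dvd_def gcd_dvd1 gcd_dvd2)
  have "1 \<le> n'" using n(1) eq by (cases n') auto
  moreover have "n' \<le> N div d"
    using n(2) d(2) eq by (simp add: less_eq_div_iff_mult_less_eq mult.commute)
  moreover have "u * real n' < real a'"
  proof -
    have "real d * (u * real n') < real d * real a'" using n(3) by (simp add: eq mult_ac)
    then show ?thesis using d(2) by simp
  qed
  moreover have "real a' \<le> v * real n'"
  proof -
    have "real d * real a' \<le> real d * (v * real n')" using n(4) by (simp add: eq mult_ac)
    then show ?thesis using d(2) by simp
  qed
  ultimately have "(n', a') \<in> frac_pairs u v (N div d)" by (simp add: frac_pairs_def)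
  moreover have "d \<in> {2..N}" using d n(2) by auto
  moreover have "p = (\<lambda>(n, a). (d * n, d * a)) (n', a')" by (simp add: na eq)
  ultimately show "p \<in> (\<Union>d\<in>{2..N}. (\<lambda>(n, a). (d * n, d * a)) ` frac_pairs u v (N div d))"
    by blast
qed

text \<open>A union bound over the common factor d replaces Moebius inversion. It removes at most
  3/4 of the main term (v - u) N^2 / 2, leaving 1/8, with errors of order N and N ln N.\<close>

lemma card_coprime_pairs_ge:
  assumes "0 \<le> u" "u \<le> v" "v \<le> 1" "N \<ge> 1"
  shows "(v - u) * (real N)\<^sup>2 / 8 - real N - 2 * real N * ln (real N) \<le> real (card (coprime_pairs u v N))"
proof -
  note fin = card_frac_pairs(1)[OF assms(1-3)]
  have "card (frac_pairs u v N - coprime_pairs u v N) \<le>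
      card (\<Union>d\<in>{2..N}. (\<lambda>(n, a). (d * n, d * a)) ` frac_pairs u v (N div d))"
    by (intro card_mono noncoprime_pairs_subset) (use fin in auto)
  also have "\<dots> \<le> (\<Sum>d\<in>{2..N}. card ((\<lambda>(n, a). (d * n, d * a)) ` frac_pairs u v (N div d)))"
    by (rule card_UN_le) simp
  also have "\<dots> \<le> (\<Sum>d\<in>{2..N}. card (frac_pairs u v (N div d)))"
    by (intro sum_mono card_image_le fin)
  finally have "real (card (frac_pairs u v N - coprime_pairs u v N)) \<le>
      (\<Sum>d\<in>{2..N}. real (card (frac_pairs u v (N div d))))"
    by (simp flip: of_nat_sum)
  also have "\<dots> \<le> (\<Sum>d\<in>{2..N}. (v - u) * (real N)\<^sup>2 / 2 * (1 / (real d)\<^sup>2) + 2 * real N * (1 / real d))"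
  proof (rule sum_mono)
    fix d assume "d \<in> {2..N}"
    have le: "real (N div d) \<le> real N / real d" by (rule of_nat_div_le_of_nat)
    have "real (card (frac_pairs u v (N div d))) \<le> (v - u) * (real (N div d))\<^sup>2 / 2 + 2 * real (N div d)"
      by (rule card_frac_pairs(3)[OF assms(1-3)])
    also have "\<dots> \<le> (v - u) * (real N / real d)\<^sup>2 / 2 + 2 * (real N / real d)"
      using assms le by (intro add_mono mult_left_mono divide_right_mono power_mono) auto
    also have "\<dots> = (v - u) * (real N)\<^sup>2 / 2 * (1 / (real d)\<^sup>2) + 2 * real N * (1 / real d)"
      by (simp add: power_divide)
    finally show "real (card (frac_pairs u v (N div d))) \<le>
      (v - u) * (real N)\<^sup>2 / 2 * (1 / (real d)\<^sup>2) + 2 * real N * (1 / real d)" .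
  qed
  also have "\<dots> = (v - u) * (real N)\<^sup>2 / 2 * (\<Sum>d=2..N. 1 / (real d)\<^sup>2) + 2 * real N * (\<Sum>d=2..N. 1 / real d)"
    by (simp only: sum.distrib sum_distrib_left)
  also have "\<dots> \<le> (v - u) * (real N)\<^sup>2 / 2 * (3 / 4) + 2 * real N * ln (real N)"
    using assms by (intro add_mono mult_left_mono sum_inverse_squares_from_2_le sum_inverse_from_2_le_ln) auto
  finally have "real (card (frac_pairs u v N - coprime_pairs u v N)) \<le>
    (v - u) * (real N)\<^sup>2 / 2 * (3 / 4) + 2 * real N * ln (real N)" .
  moreover have "real (card (frac_pairs u v N)) \<le>
      real (card (coprime_pairs u v N)) + real (card (frac_pairs u v N - coprime_pairs u v N))"
  proof -
    have "frac_pairs u v N = coprime_pairs u v N \<union> (frac_pairs u v N - coprime_pairs u v N)"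
      by (auto simp: coprime_pairs_def)
    then show ?thesis by (metis card_Un_le of_nat_add of_nat_mono)
  qed
  ultimately show ?thesis
    using card_frac_pairs(2)[OF assms(1-3), of N] by linarith
qed

text \<open>Half of the constant 1/8 is given up to absorb the error terms, which are o(4^k) at N =
  2^k.\<close>

lemma eventually_card_coprime_pairs_ge:
  assumes "0 \<le> u" "u < v" "v \<le> 1"
  shows "\<forall>\<^sub>F k in sequentially. (v - u) / 16 * 4 ^ k \<le> real (card (coprime_pairs u v (2 ^ k)))"
proof -
  have "((\<lambda>k. (2 ^ k + 2 * 2 ^ k * (real k * ln 2)) / 4 ^ k) \<longlongrightarrow> 0) sequentially"
    by real_asymp
  from order_tendstoD(2)[OF this, of "(v - u) / 16"] assms
  have "\<forall>\<^sub>F k in sequentially. (2 ^ k + 2 * 2 ^ k * (real k * ln 2)) / 4 ^ k < (v - u) / 16" by simp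
  then show ?thesis
  proof eventually_elim
    case (elim k)
    then have "2 ^ k + 2 * 2 ^ k * (real k * ln 2) \<le> (v - u) / 16 * 4 ^ k" by (simp add: field_simps)
    moreover have "(v - u) * (real (2 ^ k))\<^sup>2 / 8 - real (2 ^ k) - 2 * real (2 ^ k) * ln (real (2 ^ k))
        \<le> real (card (coprime_pairs u v (2 ^ k)))"
      using assms by (intro card_coprime_pairs_ge) auto
    moreover have "(real (2 ^ k))\<^sup>2 = 4 ^ k" "ln (real (2 ^ k)) = real k * ln 2"
      by (simp_all add: ln_realpow power2_eq_square flip: power_mult_distrib)
    ultimately show ?case by simp
  qed
qed

section \<open>Random subsets\<close>

text \<open>Chebyshev's inequality. Pairwise independence gives the count mean |C|/2 and variance
  |C|/4, and a count below |C|/4 deviates from its mean by more than |C|/4.\<close>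

lemma (in prob_space) prob_few_fair_events_le:
  assumes fin: "finite C" and ne: "C \<noteq> {}"
    and A: "\<And>p. p \<in> C \<Longrightarrow> A p \<in> events"
    and half: "\<And>p. p \<in> C \<Longrightarrow> prob (A p) = 1 / 2"
    and quarter: "\<And>p q. p \<in> C \<Longrightarrow> q \<in> C \<Longrightarrow> p \<noteq> q \<Longrightarrow> prob (A p \<inter> A q) = 1 / 4"
  shows "{\<omega> \<in> space M. real (card {p \<in> C. \<omega> \<in> A p}) < real (card C) / 4} \<in> events"
    and "prob {\<omega> \<in> space M. real (card {p \<in> C. \<omega> \<in> A p}) < real (card C) / 4} \<le> 4 / real (card C)"
proof -
  define f where "f \<omega> = (\<Sum>p\<in>C. indicat_real (A p) \<omega> - 1 / 2)" for \<omega>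
  have cnt: "real (card {p \<in> C. \<omega> \<in> A p}) = f \<omega> + real (card C) / 2" for \<omega>
    using fin by (simp add: f_def sum_subtractf indicator_def of_bool_def sum.If_cases Int_def)
  have meas [measurable]: "f \<in> borel_measurable M"
    unfolding f_def using A by measurable
  have eq: "{\<omega> \<in> space M. real (card {p \<in> C. \<omega> \<in> A p}) < real (card C) / 4} =
    {\<omega> \<in> space M. f \<omega> + real (card C) / 2 < real (card C) / 4}"
    by (simp add: cnt)
  show ev: "{\<omega> \<in> space M. real (card {p \<in> C. \<omega> \<in> A p}) < real (card C) / 4} \<in> events"
    unfolding eq by measurable
  have f2: "(f \<omega>)\<^sup>2 = (\<Sum>p\<in>C. \<Sum>q\<in>C. indicat_real (A p \<inter> A q) \<omega> - 1 / 2 * indicat_real (A p) \<omega>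
      - 1 / 2 * indicat_real (A q) \<omega> + 1 / 4)" for \<omega>
    unfolding f_def power2_eq_square sum_product
    by (intro sum.cong refl) (simp add: indicator_inter_arith algebra_simps)
  have int: "integrable M (indicat_real (A p \<inter> A q))" "integrable M (indicat_real (A p))"
    if "p \<in> C" "q \<in> C" for p q
    using A that by (auto intro!: integrable_real_indicator simp: emeasure_eq_measure)
  have int2: "integrable M (\<lambda>\<omega>. (f \<omega>)\<^sup>2)"
    unfolding f2 using int by (intro Bochner_Integration.integrable_sum Bochner_Integration.integrable_add
      Bochner_Integration.integrable_diff integrable_mult_right) auto
  have cov: "(\<integral>\<omega>. indicat_real (A p \<inter> A q) \<omega> - 1 / 2 * indicat_real (A p) \<omega>
      - 1 / 2 * indicat_real (A q) \<omega> + 1 / 4 \<partial>M) = (if p = q then 1 / 4 else 0)"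
    if pq: "p \<in> C" "q \<in> C" for p q
  proof -
    have "A p \<inter> A q \<inter> space M = A p \<inter> A q" "A p \<inter> space M = A p" "A q \<inter> space M = A q"
      using A[OF pq(1)] A[OF pq(2)] sets.sets_into_space by blast+
    then have "(\<integral>\<omega>. indicat_real (A p \<inter> A q) \<omega> - 1 / 2 * indicat_real (A p) \<omega>
      - 1 / 2 * indicat_real (A q) \<omega> + 1 / 4 \<partial>M)
      = prob (A p \<inter> A q) - 1 / 2 * prob (A p) - 1 / 2 * prob (A q) + 1 / 4"
      using int[OF pq] int[OF pq(2,1)] by (simp add: prob_space)
    then show ?thesis using half[OF pq(1)] half[OF pq(2)] quarter[OF pq] by (cases "p = q") simp_all
  qed
  have "(\<integral>\<omega>. (f \<omega>)\<^sup>2 \<partial>M) = (\<Sum>p\<in>C. \<Sum>q\<in>C. if p = q then 1 / 4 else 0)"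
  proof -
    have "(\<integral>\<omega>. (f \<omega>)\<^sup>2 \<partial>M) = (\<Sum>p\<in>C. \<Sum>q\<in>C. \<integral>\<omega>. indicat_real (A p \<inter> A q) \<omega> - 1 / 2 * indicat_real (A p) \<omega>
      - 1 / 2 * indicat_real (A q) \<omega> + 1 / 4 \<partial>M)"
      unfolding f2 using int
      by (subst Bochner_Integration.integral_sum; (intro sum.cong refl Bochner_Integration.integral_sum)?)
         (auto intro!: Bochner_Integration.integrable_sum Bochner_Integration.integrable_add
           Bochner_Integration.integrable_diff integrable_mult_right simp del: integral_mult_right_zero)
    also have "\<dots> = (\<Sum>p\<in>C. \<Sum>q\<in>C. if p = q then 1 / 4 else 0)"
      by (intro sum.cong refl cov)
    finally show ?thesis .
  qed
  also have "\<dots> = real (card C) / 4" using fin by simp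
  finally have Ef2: "(\<integral>\<omega>. (f \<omega>)\<^sup>2 \<partial>M) = real (card C) / 4" .
  have c0: "real (card C) > 0" using fin ne by (simp add: card_gt_0_iff)
  have "prob {\<omega> \<in> space M. real (card {p \<in> C. \<omega> \<in> A p}) < real (card C) / 4} \<le>
      \<P>(\<omega> in M. real (card C) / 4 \<le> \<bar>f \<omega>\<bar>)"
    unfolding eq by (intro finite_measure_mono) auto
  also have "\<dots> \<le> (real (card C) / 4) / (real (card C) / 4)\<^sup>2"
    using second_moment_method[OF meas int2, of "real (card C) / 4"] c0 by (simp add: Ef2)
  also have "\<dots> = 4 / real (card C)" using c0 by (simp add: power2_eq_square)
  finally show "prob {\<omega> \<in> space M. real (card {p \<in> C. \<omega> \<in> A p}) < real (card C) / 4} \<le> 4 / real (card C)" .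
qed

lemma card_supersets:
  assumes "finite B" "T \<subseteq> B"
  shows "card {X \<in> Pow B. T \<subseteq> X} = 2 ^ (card B - card T)"
proof -
  have "bij_betw (\<lambda>X. X \<union> T) (Pow (B - T)) {X \<in> Pow B. T \<subseteq> X}"
    by (rule bij_betwI[where g = "\<lambda>X. X - T"]) (use assms in auto)
  then have "card {X \<in> Pow B. T \<subseteq> X} = card (Pow (B - T))" by (simp add: bij_betw_same_card)
  also have "\<dots> = 2 ^ (card B - card T)"
    using assms by (simp add: card_Pow card_Diff_subset finite_subset)
  finally show ?thesis .
qed

section \<open>Membership events of uniform random subsets\<close>

context prob_space
begin

context
  fixes P :: "nat \<Rightarrow> 'a \<Rightarrow> nat set"
  assumes urs: "uniform_random_subsets M P"
begin

lemma indep_random_subsets: "indep_vars (\<lambda>n. count_space (Pow {1..n})) P {1..}"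
  using urs by (simp add: uniform_random_subsets_def)

lemma measurable_random_subset: "n \<ge> 1 \<Longrightarrow> P n \<in> measurable M (count_space (Pow {1..n}))"
  using indep_random_subsets unfolding indep_vars_def by auto

lemma random_subset_subset: "n \<ge> 1 \<Longrightarrow> \<omega> \<in> space M \<Longrightarrow> P n \<omega> \<subseteq> {1..n}"
  using measurable_space[OF measurable_random_subset] by fastforce

lemma vimage_random_subset:
  "n \<ge> 1 \<Longrightarrow> P n -` {X \<in> Pow {1..n}. T \<subseteq> X} \<inter> space M = {\<omega> \<in> space M. T \<subseteq> P n \<omega>}"
  using random_subset_subset by auto

lemma random_subset_event: "n \<ge> 1 \<Longrightarrow> {\<omega> \<in> space M. T \<subseteq> P n \<omega>} \<in> events"
  using measurable_sets[OF measurable_random_subset, of n "{X \<in> Pow {1..n}. T \<subseteq> X}"]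
  by (simp only: vimage_random_subset) auto

lemma prob_superset:
  assumes "n \<ge> 1" "T \<subseteq> {1..n}"
  shows "prob {\<omega> \<in> space M. T \<subseteq> P n \<omega>} = 1 / 2 ^ card T"
proof -
  have "prob {\<omega> \<in> space M. T \<subseteq> P n \<omega>} =
      measure (distr M (count_space (Pow {1..n})) (P n)) {X \<in> Pow {1..n}. T \<subseteq> X}"
    using assms measurable_random_subset[of n] vimage_random_subset[of n T]
    by (subst measure_distr) auto
  also have "\<dots> = measure (uniform_count_measure (Pow {1..n})) {X \<in> Pow {1..n}. T \<subseteq> X}"
    using urs assms(1) by (simp add: uniform_random_subsets_def)
  also have "\<dots> = 2 ^ (n - card T) / 2 ^ n"
    using card_supersets[OF _ assms(2)] by (subst measure_uniform_count_measure) (auto simp: card_Pow)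
  also have "\<dots> = 1 / 2 ^ card T"
    using card_mono[OF _ assms(2)] by (simp add: power_diff)
  finally show ?thesis .
qed

text \<open>Pairwise independence has two sources: for equal denominators the uniform law on the
  power set, for different ones the independence of the choices.\<close>

lemma prob_two_members:
  assumes "1 \<le> a" "a \<le> n" "1 \<le> b" "b \<le> m" "(n, a) \<noteq> (m, b)"
  shows "prob ({\<omega> \<in> space M. {a} \<subseteq> P n \<omega>} \<inter> {\<omega> \<in> space M. {b} \<subseteq> P m \<omega>}) = 1 / 4"
proof (cases "n = m")
  case True
  have "{\<omega> \<in> space M. {a} \<subseteq> P n \<omega>} \<inter> {\<omega> \<in> space M. {b} \<subseteq> P m \<omega>} = {\<omega> \<in> space M. {a, b} \<subseteq> P n \<omega>}"
    using True by auto
  then show ?thesis using prob_superset[of n "{a, b}"] assms True by auto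
next
  case False
  define T where "T i = (if i = n then {a} else {b})" for i
  have vim: "P i -` {X \<in> Pow {1..i}. T i \<subseteq> X} \<inter> space M = {\<omega> \<in> space M. T i \<subseteq> P i \<omega>}"
    if "i \<in> {n, m}" for i
    using that assms by (intro vimage_random_subset) auto
  have "prob (\<Inter>i\<in>{n, m}. {\<omega> \<in> space M. T i \<subseteq> P i \<omega>}) =
      prob (\<Inter>i\<in>{n, m}. P i -` {X \<in> Pow {1..i}. T i \<subseteq> X} \<inter> space M)"
    by (intro arg_cong[of _ _ prob] INF_cong refl vim[symmetric])
  also have "\<dots> = (\<Prod>i\<in>{n, m}. prob (P i -` {X \<in> Pow {1..i}. T i \<subseteq> X} \<inter> space M))"
    using assms by (intro indep_varsD[OF indep_random_subsets]) auto
  also have "\<dots> = (\<Prod>i\<in>{n, m}. prob {\<omega> \<in> space M. T i \<subseteq> P i \<omega>})"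
    by (intro prod.cong refl arg_cong[of _ _ prob] vim)
  also have "\<dots> = prob {\<omega> \<in> space M. {a} \<subseteq> P n \<omega>} * prob {\<omega> \<in> space M. {b} \<subseteq> P m \<omega>}"
    using False by (simp add: T_def)
  also have "\<dots> = 1 / 2 * (1 / 2)"
    using assms by (intro arg_cong2[of _ _ _ _ "(*)"]) (subst prob_superset; simp)+
  finally show ?thesis using False by (simp add: T_def)
qed

text \<open>The event that fewer than a quarter of the reduced pairs survive has probability at most
  64 / ((v - u) 4^k) for large k. This is summable, so Borel-Cantelli applies; 1/64 is a quarter of
  1/16.\<close>

lemma AE_many_coprime_pairs:
  assumes uv: "0 \<le> u" "u < v" "v \<le> 1"
  shows "AE \<omega> in M. \<forall>\<^sub>F k in sequentially.
    (v - u) / 64 * 4 ^ k \<le> real (card {(n, a) \<in> coprime_pairs u v (2 ^ k). a \<in> P n \<omega>})"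
proof -
  define C where "C k = coprime_pairs u v (2 ^ k)" for k
  define A where "A p = {\<omega> \<in> space M. {snd p} \<subseteq> P (fst p) \<omega>}" for p
  define Bad where "Bad k = {\<omega> \<in> space M. real (card {p \<in> C k. \<omega> \<in> A p}) < real (card (C k)) / 4}" for k
  have fin: "finite (C k)" for k
    using uv finite_coprime_pairs by (simp add: C_def)
  \<comment> \<open>The strict lower bound with u >= 0 excludes a = 0, and v <= 1 gives a <= n, so
    each pair is a candidate for membership in \<open>P n\<close>.\<close>
  have mem: "1 \<le> fst p" "1 \<le> snd p" "snd p \<le> fst p" if p: "p \<in> C k" for p k
  proof -
    have *: "1 \<le> fst p" "u * real (fst p) < real (snd p)" "real (snd p) \<le> v * real (fst p)"
      using p by (auto simp: C_def coprime_pairs_def frac_pairs_def)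
    moreover have "0 \<le> u * real (fst p)" "v * real (fst p) \<le> 1 * real (fst p)"
      using uv by (simp, intro mult_right_mono) auto
    ultimately have "0 < real (snd p)" "real (snd p) \<le> real (fst p)" by linarith+
    then show "1 \<le> fst p" "1 \<le> snd p" "snd p \<le> fst p" using * by auto
  qed
  have A: "A p \<in> events" "prob (A p) = 1 / 2" if "p \<in> C k" for p k
    using mem[OF that] random_subset_event[of "fst p" "{snd p}"] prob_superset[of "fst p" "{snd p}"]
    by (auto simp: A_def)
  have AA: "prob (A p \<inter> A q) = 1 / 4" if "p \<in> C k" "q \<in> C k" "p \<noteq> q" for p q k
    unfolding A_def using mem[OF that(1)] mem[OF that(2)] that(3) 
    by (intro prob_two_members) (auto simp: prod_eq_iff)
  have ev: "\<forall>\<^sub>F k in sequentially. (v - u) / 16 * 4 ^ k \<le> real (card (C k))"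
    unfolding C_def by (rule eventually_card_coprime_pairs_ge[OF uv])
  have Bad_ev: "Bad k \<in> events" for k
  \<comment> \<open>For small k there may be no pairs at all; the bad event is then empty, as it
    asks for 0 < 0.\<close>
  proof (cases "C k = {}")
    case False
    then show ?thesis unfolding Bad_def
      by (intro prob_few_fair_events_le(1) fin A[of _ k] AA[of _ k]) auto
  qed (simp add: Bad_def)
  have "summable (\<lambda>k. prob (Bad k))"
  proof (rule summable_comparison_test_ev)
    show "\<forall>\<^sub>F k in sequentially. norm (prob (Bad k)) \<le> 64 / (v - u) * (1 / 4) ^ k"
      using ev
    proof eventually_elim
      case (elim k)
      have pos: "0 < (v - u) / 16 * 4 ^ k" using uv by simp
      then have "C k \<noteq> {}" using elim by auto
      then have "prob (Bad k) \<le> 4 / real (card (C k))"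
        unfolding Bad_def by (intro prob_few_fair_events_le(2) fin A[of _ k] AA[of _ k]) auto
      also have "\<dots> \<le> 4 / ((v - u) / 16 * 4 ^ k)"
        using pos elim by (intro divide_left_mono) auto
      also have "\<dots> = 64 / (v - u) * (1 / 4) ^ k" using uv by (simp add: field_simps)
      finally show ?case by simp
    qed
    show "summable (\<lambda>k. 64 / (v - u) * (1 / 4) ^ k)"
      by (intro summable_mult summable_geometric) simp
  qed
  then have "AE \<omega> in M. \<forall>\<^sub>F k in sequentially. \<omega> \<in> space M - Bad k"
    by (intro borel_cantelli_AE1 Bad_ev) (simp_all add: emeasure_eq_measure)
  then show ?thesis
  proof eventually_elim
    case (elim \<omega>)
    then show ?case using ev
    proof eventually_elim
      case (elim k)
      have "{p \<in> C k. \<omega> \<in> A p} = {(n, a) \<in> coprime_pairs u v (2 ^ k). a \<in> P n \<omega>}"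
        using elim by (auto simp: A_def C_def)
      then show ?case using elim by (auto simp: Bad_def)
    qed
  qed
qed

end

end

section \<open>Khintchine dichotomy\<close>

lemma coprime_fractions_eq:
  assumes "coprime n a" "coprime m b" "n \<ge> 1" "m \<ge> 1" "real a / real n = real b / real m"
  shows "n = m \<and> a = b"
proof -
  have "real (a * m) = real (b * n)" using assms by (simp add: field_simps)
  then have "a * m = b * n" by (simp only: of_nat_eq_iff)
  then show ?thesis
    using coprime_crossproduct_nat[of a n b m] assms by (auto simp: coprime_commute mult.commute)
qed

lemma fractions_separated:
  assumes "1 \<le> n" "n \<le> N" "1 \<le> m" "m \<le> N" "real a / real n \<noteq> real b / real m"
  shows "1 / (real N)\<^sup>2 \<le> \<bar>real a / real n - real b / real m\<bar>"
proof -
  have eq: "real a / real n - real b / real m = of_int (int a * int m - int b * int n) / (real n * real m)"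
    using assms by (simp add: field_simps)
  then have "int a * int m - int b * int n \<noteq> 0"
    using assms(5) by (metis div_0 eq_iff_diff_eq_0 of_int_0)
  then have "1 \<le> \<bar>int a * int m - int b * int n\<bar>" by linarith
  then have ge: "1 \<le> \<bar>real_of_int (int a * int m - int b * int n)\<bar>" by linarith
  have "1 / (real N)\<^sup>2 \<le> 1 / (real n * real m)"
    using assms by (intro divide_left_mono) (auto simp: power2_eq_square intro!: mult_mono)
  also have "\<dots> \<le> \<bar>real_of_int (int a * int m - int b * int n)\<bar> / (real n * real m)"
    using ge by (intro divide_right_mono) auto
  also have "\<dots> = \<bar>real a / real n - real b / real m\<bar>"
    by (simp add: eq abs_divide abs_mult del: of_int_diff)
  finally show ?thesis .
qed

text \<open>Cauchy condensation, contraposed. Truncation at 4^-k is harmless: an active truncation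
  makes the term equal to 1, and the terms of a convergent series are eventually below 1.\<close>

lemma condensed_not_summable:
  fixes \<Psi> :: "nat \<Rightarrow> real"
  assumes nonneg: "\<forall>n\<ge>1. 0 \<le> \<Psi> n" and anti: "antimono_on {1..} \<Psi>"
    and div: "\<not> summable (\<lambda>n. real n * \<Psi> n)"
  shows "\<not> summable (\<lambda>k. 4 ^ k * min (\<Psi> (2 ^ k)) (1 / 4 ^ k))"
proof
  assume sm: "summable (\<lambda>k. 4 ^ k * min (\<Psi> (2 ^ k)) (1 / 4 ^ k))"
  have "\<forall>\<^sub>F k in sequentially. 4 ^ k * min (\<Psi> (2 ^ k)) (1 / 4 ^ k) < 1"
    using order_tendstoD(2)[OF summable_LIMSEQ_zero[OF sm]] by simp
  then have ev: "\<forall>\<^sub>F k in sequentially. 4 ^ k * min (\<Psi> (2 ^ k)) (1 / 4 ^ k) = 4 ^ k * \<Psi> (2 ^ k)"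
    by eventually_elim (auto simp: min_def split: if_splits)
  have sm2: "summable (\<lambda>k. 4 ^ k * \<Psi> (2 ^ k))"
    using sm summable_cong[OF ev] by simp
  define s where "s = (\<Sum>k. 4 ^ k * \<Psi> (2 ^ k))"
  have nn: "0 \<le> real n * \<Psi> n" for n using nonneg by (cases "n = 0") auto
  \<comment> \<open>A block of 2^k terms, each at most 2^(k+1) \<Psi>(2^k).\<close>
  have block: "(\<Sum>n\<in>{2^k..<2^Suc k}. real n * \<Psi> n) \<le> 2 * (4 ^ k * \<Psi> (2 ^ k))" for k
  proof -
    have "(\<Sum>n\<in>{2^k..<2^Suc k}. real n * \<Psi> n) \<le> (\<Sum>n\<in>{2^k..<2^Suc k :: nat}. 2 ^ Suc k * \<Psi> (2 ^ k))"
    proof (rule sum_mono)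
      fix n :: nat assume n: "n \<in> {2^k..<2^Suc k}"
      have n1: "1 \<le> n" using n by (meson atLeastLessThan_iff one_le_numeral one_le_power order_trans)
      have "\<Psi> n \<le> \<Psi> (2 ^ k)"
        using anti n n1 by (auto simp: monotone_on_def)
      moreover have "real n \<le> 2 ^ Suc k"
        using n by (metis atLeastLessThan_iff less_imp_le of_nat_le_iff of_nat_numeral of_nat_power)
      ultimately show "real n * \<Psi> n \<le> 2 ^ Suc k * \<Psi> (2 ^ k)"
        using nonneg n1 by (intro mult_mono) auto
    qed
    also have "\<dots> = 2 ^ k * (2 ^ Suc k * \<Psi> (2 ^ k))" by simp
    also have "\<dots> = 2 * ((2 * 2) ^ k * \<Psi> (2 ^ k))"
      by (simp only: power_mult_distrib power_Suc mult_ac)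
    finally show ?thesis by simp
  qed
  have part: "(\<Sum>n\<in>{1..<2^K}. real n * \<Psi> n) \<le> 2 * (\<Sum>k<K. 4 ^ k * \<Psi> (2 ^ k))" for K
  proof (induction K)
    case (Suc K)
    have "(\<Sum>n\<in>{1..<2^Suc K}. real n * \<Psi> n) =
        (\<Sum>n\<in>{1..<2^K}. real n * \<Psi> n) + (\<Sum>n\<in>{2^K..<2^Suc K}. real n * \<Psi> n)"
      by (rule sum.atLeastLessThan_concat[symmetric]) auto
    also have "\<dots> \<le> 2 * (\<Sum>k<K. 4 ^ k * \<Psi> (2 ^ k)) + 2 * (4 ^ K * \<Psi> (2 ^ K))"
      by (intro add_mono Suc block)
    finally show ?case by simp
  qed simp
  have "(\<Sum>n\<le>N. real n * \<Psi> n) \<le> 2 * s" for N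
  proof -
    have "(\<Sum>n\<le>N. real n * \<Psi> n) = (\<Sum>n\<in>{1..N}. real n * \<Psi> n)"
      by (rule sum.mono_neutral_right) auto
    also have "\<dots> \<le> (\<Sum>n\<in>{1..<2^Suc N}. real n * \<Psi> n)"
    proof (rule sum_mono2)
      show "{1..N} \<subseteq> {1..<2 ^ Suc N}"
      proof
        fix n assume n: "n \<in> {1..N}"
        have "N < 2 ^ N" by (rule less_exp)
        also have "(2::nat) ^ N \<le> 2 ^ Suc N" by simp
        finally show "n \<in> {1..<2 ^ Suc N}" using n by auto
      qed
    qed (use nn in auto)
    also have "\<dots> \<le> 2 * (\<Sum>k<Suc N. 4 ^ k * \<Psi> (2 ^ k))" by (rule part)
    also have "\<dots> \<le> 2 * s"
      unfolding s_def using nonneg by (intro mult_left_mono sum_le_suminf sm2) auto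
    finally show ?thesis .
  qed
  then have "summable (\<lambda>n. real n * \<Psi> n)" by (intro bounded_imp_summable nn)
  then show False using div by simp
qed

section \<open>The two cases for a fixed sequence of sets\<close>

text \<open>A deterministic statement: \<open>dens\<close> carries what is needed from the random
  choice and does not mention \<Psi>. Every tail union \<open>E l\<close> fills the proportion
  c^2/28 of each dyadic interval, so its complement in [0,1] is null.\<close>

lemma W_approx_full_measure:
  fixes P :: "nat \<Rightarrow> nat set" and \<Psi> :: "nat \<Rightarrow> real"
  assumes P: "\<And>n. n \<ge> 1 \<Longrightarrow> P n \<subseteq> {1..n}" and c: "c > 0"
    and dens: "\<And>m i. i < 2 ^ m \<Longrightarrow> \<forall>\<^sub>F k in sequentially. c * (1 / 2 ^ m) * 4 ^ k \<le>
      real (card {(n, a) \<in> coprime_pairs (real i / 2 ^ m) (real (i + 1) / 2 ^ m) (2 ^ k). a \<in> P n})"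
    and nonneg: "\<forall>n\<ge>1. 0 \<le> \<Psi> n" and anti: "antimono_on {1..} \<Psi>"
    and div: "\<not> summable (\<lambda>n. real n * \<Psi> n)"
  shows "emeasure lebesgue (W_approx P \<Psi>) = 1"
proof -
  \<comment> \<open>The levels are cumulative, so one fraction recurs at all later levels. Lying in
    balls of infinitely many levels therefore does not by itself give infinitely many pairs.\<close>
  define Q where "Q k = {(n, a). 1 \<le> n \<and> n \<le> 2 ^ k \<and> a \<in> P n \<and> coprime n a}" for k :: nat
  define q where "q = (\<lambda>(n, a). real a / real n :: real)"
  define S where "S k = q ` Q k" for k
  define \<psi> where "\<psi> k = min (\<Psi> (2 ^ k)) (1 / 4 ^ k)" for k
  define E where "E m = (\<Union>k\<in>{m..}. \<Union>s\<in>S k. {s - \<psi> k<..<s + \<psi> k})" for m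
  have "Q k \<subseteq> (SIGMA n:{1..2^k}. {1..n})" for k using P by (fastforce simp: Q_def)
  then have finQ: "finite (Q k)" for k by (rule finite_subset) auto
  have injq: "inj_on q (Q k)" for k
  proof (rule inj_onI)
    fix p p' assume "p \<in> Q k" "p' \<in> Q k" "q p = q p'"
    then show "p = p'"
      using coprime_fractions_eq[of "fst p" "snd p" "fst p'" "snd p'"]
      by (auto simp: Q_def q_def)
  qed
  have psi: "0 \<le> \<psi> k" "\<psi> k \<le> 1 / 4 ^ k" for k using nonneg by (auto simp: \<psi>_def)
  have sep: "1 / 4 ^ k \<le> \<bar>x - y\<bar>" if "x \<in> S k" "y \<in> S k" "x \<noteq> y" for x y k
  proof -
    obtain n a m b where "x = real a / real n" "y = real b / real m"
        "1 \<le> n" "n \<le> 2 ^ k" "1 \<le> m" "m \<le> 2 ^ k"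
      using \<open>x \<in> S k\<close> \<open>y \<in> S k\<close> by (auto simp: S_def Q_def q_def)
    then have "1 / (real (2 ^ k))\<^sup>2 \<le> \<bar>x - y\<bar>" using fractions_separated[of n "2 ^ k" m a b] that(3) by simp
    then show ?thesis by (simp add: power2_eq_square flip: power_mult_distrib)
  qed
  have dyadic: "c\<^sup>2 / 28 * (1 / 2 ^ m) \<le> measure lborel ({real i / 2 ^ m<..real (i + 1) / 2 ^ m} \<inter> E l)"
    if i: "i < 2 ^ m" for m i l
  proof -
    define u v where uv: "u = real i / 2 ^ m" "v = real (i + 1) / 2 ^ m"
    have diff: "v - u = 1 / 2 ^ m" by (simp add: uv field_simps)
    have "u < v" unfolding uv by (intro divide_strict_right_mono) auto
    \<comment> \<open>Reduced fractions determine their pairs, so counting pairs is the same as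
      counting points of \<open>S k\<close>.\<close>
    have "card {(n, a) \<in> coprime_pairs u v (2 ^ k). a \<in> P n} = card (S k \<inter> {u<..v})" for k
    proof -
      have "S k \<inter> {u<..v} = q ` {(n, a) \<in> coprime_pairs u v (2 ^ k). a \<in> P n}"
        by (force simp: S_def Q_def q_def coprime_pairs_def frac_pairs_def field_simps)
      moreover have "inj_on q {(n, a) \<in> coprime_pairs u v (2 ^ k). a \<in> P n}"
        by (rule inj_on_subset[OF injq[of k]]) (auto simp: Q_def coprime_pairs_def frac_pairs_def)
      ultimately show ?thesis by (simp add: card_image)
    qed
    then have "\<forall>\<^sub>F k in sequentially. c * (v - u) * 4 ^ k \<le> real (card (S k \<inter> {u<..v}))"
      using dens[OF i, folded uv] by (simp add: diff)
    from dense_separated_cover[OF _ sep \<open>u < v\<close> c this psi, of l]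
    have "c\<^sup>2 / 28 * (v - u) \<le> measure lborel ({u<..v} \<inter> E l)"
      using condensed_not_summable[OF nonneg anti div] finQ by (simp add: E_def S_def \<psi>_def)
    then show ?thesis by (simp only: diff) (simp only: uv)
  qed
  have openE: "open (E l)" for l
    unfolding E_def by (intro open_UN ballI open_greaterThanLessThan)
  have "measure lborel ({0..1} - E l) = 0" for l
  proof (rule compact_null_if_dyadic_density_less_1[where c = "c\<^sup>2 / 28"])
    show "compact ({0..1} - E l)" using openE by (intro compact_diff) auto
    fix m i :: nat assume i: "i < 2 ^ m"
    define I where "I = {real i / 2 ^ m<..real (i + 1) / 2 ^ m}"
    have If: "I \<in> fmeasurable lborel"
      unfolding I_def by (rule fmeasurableI2[OF fmeasurable_cbox[of "real i / 2 ^ m" "real (i + 1) / 2 ^ m"]]) auto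
    have IE: "I \<inter> E l \<in> sets lborel" using If openE by auto
    have "measure lborel (({0..1} - E l) \<inter> I) \<le> measure lborel (I - I \<inter> E l)"
      using If IE openE by (intro measure_mono_fmeasurable) (auto intro!: fmeasurable_Diff)
    also have "\<dots> = measure lborel I - measure lborel (I \<inter> E l)"
      using If IE by (subst measure_Diff) (auto simp: fmeasurable_def)
    also have "measure lborel I = 1 / 2 ^ m" by (simp add: I_def field_simps)
    also have "1 / 2 ^ m - measure lborel (I \<inter> E l) \<le> 1 / 2 ^ m - c\<^sup>2 / 28 * (1 / 2 ^ m)"
      unfolding I_def by (intro diff_left_mono dyadic i)
    also have "\<dots> = (1 - c\<^sup>2 / 28) / 2 ^ m" by (simp add: diff_divide_distrib)
    finally show "measure lborel (({0..1} - E l) \<inter> {real i / 2 ^ m<..real (i + 1) / 2 ^ m}) \<le> (1 - c\<^sup>2 / 28) / 2 ^ m"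
      by (simp only: I_def)
  qed (use c in auto)
  moreover have fE: "{0..1} - E l \<in> fmeasurable lborel" for l
    using openE by (intro fmeasurable_compact compact_diff) auto
  ultimately have nullE: "{0..1} - E l \<in> null_sets lborel" for l
    using emeasure_eq_measure2[OF fE[of l]] by (intro null_setsI fmeasurableD[OF fE]) simp
  have sub: "{0..1} - W_approx P \<Psi> \<subseteq> \<rat> \<union> (\<Union>l. {0..1} - E l)"
  proof
    fix x assume x: "x \<in> {0..1} - W_approx P \<Psi>"
    show "x \<in> \<rat> \<union> (\<Union>l. {0..1} - E l)"
    proof (rule ccontr)
      assume nx: "x \<notin> \<rat> \<union> (\<Union>l. {0..1} - E l)"
      define Fs where "Fs = {(n, a). n \<ge> 1 \<and> a \<in> P n \<and> \<bar>x - real a / real n\<bar> < \<Psi> n}"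
      have fin: "finite Fs" using x by (auto simp: W_approx_def Fs_def)
      \<comment> \<open>The distance from x to its finitely many approximants, positive because x is
        irrational; the inserted 1 covers the case of none. A ball of radius below \<delta> that
        contains x then yields a further pair.\<close>
      define \<delta> where "\<delta> = Min (insert 1 ((\<lambda>p. \<bar>x - q p\<bar>) ` Fs))"
      have "\<delta> > 0"
        using fin nx by (auto simp: \<delta>_def q_def)
      have \<delta>: "\<delta> \<le> \<bar>x - q p\<bar>" if "p \<in> Fs" for p
        unfolding \<delta>_def using fin that by (intro Min_le) auto
      obtain l where l: "(1/4::real) ^ l < \<delta>"
        using real_arch_pow_inv[of \<delta> "1/4"] \<open>\<delta> > 0\<close> by auto
      have "x \<in> E l" using nx x by blast
      then obtain k n a where k: "k \<ge> l" "(n, a) \<in> Q k" "\<bar>x - real a / real n\<bar> < \<psi> k"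
        by (fastforce simp: E_def S_def q_def)
      \<comment> \<open>Monotonicity enters here: the denominator n is at most 2^k, so the radius
        used at level k is admissible for n.\<close>
      have "\<psi> k \<le> \<Psi> (2 ^ k)" by (simp add: \<psi>_def)
      also have "\<dots> \<le> \<Psi> n" using anti k(2) by (auto simp: monotone_on_def Q_def)
      finally have "(n, a) \<in> Fs" using k by (auto simp: Fs_def Q_def)
      then have "\<delta> \<le> \<bar>x - real a / real n\<bar>" using \<delta> by (force simp: q_def)
      also have "\<dots> < 1 / 4 ^ k" using k(3) psi(2)[of k] by linarith
      also have "\<dots> \<le> (1 / 4) ^ l" using k(1) by (simp add: power_one_over frac_le power_increasing)
      finally show False using l by simp
    qed
  qed
  have W: "W_approx P \<Psi> \<in> sets lborel" using W_approx_borel by simp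
  have "\<rat> \<union> (\<Union>l. {0..1} - E l) \<in> null_sets lborel"
    using countable_imp_null_set_lborel[OF countable_rat] nullE
    by (intro null_sets.Un null_sets_UN) auto
  then have "{0..1} - W_approx P \<Psi> \<in> null_sets lborel"
    by (rule null_sets_subset[OF _ _ sub]) (use W in auto)
  moreover have "W_approx P \<Psi> \<subseteq> {0..1}" by (auto simp: W_approx_def)
  ultimately have "emeasure lborel (W_approx P \<Psi>) = emeasure lborel {0..1::real}"
    using emeasure_Diff_null_set[of "{0..1} - W_approx P \<Psi>" lborel "{0..1}"] by (simp add: double_diff)
  then show ?thesis using W by simp
qed

text \<open>Borel-Cantelli for the unions over a in \<open>P n\<close>: at most n intervals of
  length 2 \<Psi>(n) each.\<close>

lemma W_approx_null:
  fixes P :: "nat \<Rightarrow> nat set" and \<Psi> :: "nat \<Rightarrow> real"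
  assumes P: "\<And>n. n \<ge> 1 \<Longrightarrow> P n \<subseteq> {1..n}"
    and nonneg: "\<forall>n\<ge>1. 0 \<le> \<Psi> n" and sm: "summable (\<lambda>n. real n * \<Psi> n)"
  shows "emeasure lebesgue (W_approx P \<Psi>) = 0"
proof -
  \<comment> \<open>Index 0 is cut off, since neither \<open>P 0\<close> nor the sign of \<Psi>(0)
    is controlled.\<close>
  define A where "A n = (if n = 0 then {} else \<Union>a\<in>P n. {real a / real n - \<Psi> n<..<real a / real n + \<Psi> n})" for n
  have finP: "finite (P n)" if "n \<ge> 1" for n using P[OF that] finite_subset by blast
  have Bf: "{real a / real n - \<Psi> n<..<real a / real n + \<Psi> n} \<in> fmeasurable lborel" for a n
    by (rule fmeasurableI2[OF fmeasurable_cbox[of "real a / real n - \<Psi> n" "real a / real n + \<Psi> n"]]) auto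
  have Af: "A n \<in> fmeasurable lborel" for n
    using Bf finP by (auto simp: A_def intro!: fmeasurable.finite_UN)
  have mA: "measure lborel (A n) \<le> 2 * (real n * \<Psi> n)" for n
  proof (cases "n = 0")
    case False
    then have n: "n \<ge> 1" by simp
    have "measure lborel (A n) \<le> (\<Sum>a\<in>P n. measure lborel {real a / real n - \<Psi> n<..<real a / real n + \<Psi> n})"
      using False finP[OF n] by (auto simp: A_def intro!: measure_UNION_le)
    also have "\<dots> = real (card (P n)) * (2 * \<Psi> n)" using nonneg n by simp
    also have "\<dots> \<le> real n * (2 * \<Psi> n)"
      using nonneg n card_mono[OF _ P[OF n]] by (intro mult_right_mono) auto
    finally show ?thesis by simp
  qed (simp add: A_def)
  have "limsup A \<in> null_sets lborel"
  proof (rule borel_cantelli_limsup1)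
    show "summable (\<lambda>n. measure lborel (A n))"
      by (rule summable_comparison_test'[OF summable_mult[OF sm, of 2]]) (use mA in auto)
  qed (use Af in \<open>auto simp: fmeasurable_def\<close>)
  moreover have "W_approx P \<Psi> \<subseteq> limsup A"
  proof
    fix x assume "x \<in> W_approx P \<Psi>"
    then have inf: "infinite {(n, a). n \<ge> 1 \<and> a \<in> P n \<and> \<bar>x - real a / real n\<bar> < \<Psi> n}"
      by (simp add: W_approx_def)
    show "x \<in> limsup A"
    proof (unfold limsup_INF_SUP, rule INT_I)
      fix N :: nat
      \<comment> \<open>Each n contributes finitely many pairs, so infinitely many pairs force
        arbitrarily large n.\<close>
      have "\<not> {(n, a). n \<ge> 1 \<and> a \<in> P n \<and> \<bar>x - real a / real n\<bar> < \<Psi> n} \<subseteq> Sigma {1..N} P"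
        using inf finP finite_subset[OF _ finite_SigmaI[of "{1..N}" P]] by auto
      then obtain n a where "n \<ge> 1" "a \<in> P n" "\<bar>x - real a / real n\<bar> < \<Psi> n" "(n, a) \<notin> Sigma {1..N} P"
        by blast
      then show "x \<in> (\<Union>n\<in>{N..}. A n)"
        by (intro UN_I[of n]) (auto simp: A_def abs_less_iff intro!: bexI[of _ a])
    qed
  qed
  ultimately have "W_approx P \<Psi> \<in> null_sets lborel"
    using W_approx_borel by (auto intro: null_sets_subset)
  then show ?thesis using W_approx_borel by (auto simp: null_sets_def)
qed

theorem theorem1p1:
  fixes M :: "'w measure" and P :: "nat \<Rightarrow> 'w \<Rightarrow> nat set"
  assumes "prob_space M"
    and "uniform_random_subsets M P"
  shows "AE \<omega> in M. \<forall>\<Psi> :: nat \<Rightarrow> real.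
           (\<forall>n\<ge>1. 0 \<le> \<Psi> n) \<longrightarrow> antimono_on {1..} \<Psi> \<longrightarrow>
             (\<not> summable (\<lambda>n. real n * \<Psi> n) \<longrightarrow>
                emeasure lebesgue (W_approx (\<lambda>n. P n \<omega>) \<Psi>) = 1) \<and>
             (summable (\<lambda>n. real n * \<Psi> n) \<longrightarrow>
                emeasure lebesgue (W_approx (\<lambda>n. P n \<omega>) \<Psi>) = 0)"
proof -
  interpret prob_space M by fact
  \<comment> \<open>There are countably many dyadic intervals, so one null set covers all
    exceptions. It is fixed before \<Psi> is chosen, which makes the uncountable quantifier over
    \<Psi> harmless.\<close>
  have "AE \<omega> in M. \<forall>m i. i < 2 ^ m \<longrightarrow> (\<forall>\<^sub>F k in sequentially. 1 / 64 * (1 / 2 ^ m) * 4 ^ k \<le>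
      real (card {(n, a) \<in> coprime_pairs (real i / 2 ^ m) (real (i + 1) / 2 ^ m) (2 ^ k). a \<in> P n \<omega>}))"
  proof (intro AE_all_countable[THEN iffD2] allI)
    fix m i :: nat
    show "AE \<omega> in M. i < 2 ^ m \<longrightarrow> (\<forall>\<^sub>F k in sequentially. 1 / 64 * (1 / 2 ^ m) * 4 ^ k \<le>
      real (card {(n, a) \<in> coprime_pairs (real i / 2 ^ m) (real (i + 1) / 2 ^ m) (2 ^ k). a \<in> P n \<omega>}))"
    proof (cases "i < 2 ^ m")
      case True
      then have "real (i + 1) \<le> real (2 ^ m)" by (simp only: of_nat_le_iff)
      then have "real (i + 1) / 2 ^ m \<le> 1" by simp
      moreover have "real (i + 1) / 2 ^ m - real i / 2 ^ m = 1 / 2 ^ m" by (simp add: field_simps)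
      moreover have "real i / 2 ^ m < real (i + 1) / 2 ^ m" by (intro divide_strict_right_mono) auto
      ultimately show ?thesis
        using AE_many_coprime_pairs[OF assms(2), of "real i / 2 ^ m" "real (i + 1) / 2 ^ m"]
        by (simp add: mult.commute)
    qed simp
  qed
  then show ?thesis
    using AE_space
  proof eventually_elim
    case (elim \<omega>)
    have P: "\<And>n. n \<ge> 1 \<Longrightarrow> P n \<omega> \<subseteq> {1..n}"
      using random_subset_subset[OF assms(2)] elim(2) by blast
    show ?case
      using W_approx_full_measure[of "\<lambda>n. P n \<omega>" "1 / 64", OF P] W_approx_null[of "\<lambda>n. P n \<omega>", OF P] elim(1)
      by (auto simp del: of_nat_add)
  qed
qed

end
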